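(* Let $X=\mathrm{puz}(\Gamma_{2,3})$ be the state graph of the cylindrical $5$-puzzle, identified via the encoding $f\mapsto(\sigma_f,x_f,y_f)$ with the Cayley graph $\mathrm{Cay}(G,\{\hat{\mathtt L},\hat{\mathtt R},\hat{\mathtt V}\})$, where $G=S_5\times\mathbb{Z}/2\mathbb{Z}\times\mathbb{Z}/3\mathbb{Z}$. Consider the word of length $24$ over $\{\mathtt L,\mathtt R,\mathtt V\}$ $$(s_1,\ldots,s_{24})=\mathtt{VLVRVLVRVRVL}\;\mathtt{VLVRVLVRVRVR},$$ let $(u_1,\ldots,u_{360})$ be its $15$-fold repetition, and put $q_0=(\mathrm{id},0,0)$ and $q_i=\hat u_1\hat u_2\cdots\hat u_i\in G$ for $1\le i\le 360$. Let $a_0=(\mathrm{id},0,0)$ and $a_1=(\mathrm{id},1,0)$ in $G$, and for $j=0,1$ let $$C_j=(a_j,\ a_jq_1,\ a_jq_2,\ \ldots,\ a_jq_{360}).$$ Then $C_0$ and $C_1$ form a $2$-cycle cover of $X$: each $C_j$ is a simple cycle of length $360$ in $X$ (closed, with $a_jq_{360}=a_j$), and $C_0$ and $C_1$ are vertex-disjoint, so that together they contain every vertex of $X$ exactly once.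
   Context: Sliding block puzzle. For a finite simple graph $\Gamma$ with $n+1$ vertices, a position is a bijection $f:V(\Gamma)\to\{0,1,\ldots,n\}$; the vertex $f^{-1}(0)$ is called blank. A move transforms $f$ into $g=f\circ(v,w)$, where $v,w$ are adjacent vertices of $\Gamma$, one of which is blank in $f$, and $(v,w)$ is the transposition of $v$ and $w$. The state graph $\mathrm{puz}(\Gamma)$ is the undirected graph whose vertices are the positions, with $f,g$ adjacent iff a move transforms $f$ into $g$. The cylindrical grid $\Gamma_{2,3}$ has vertex set $\mathbb{Z}/2\mathbb{Z}\times\mathbb{Z}/3\mathbb{Z}$, with exactly one edge between $v$ and $w$ iff $v-w\in\{\pm(1,0),\pm(0,1)\}$. The puzzle on $\Gamma_{2,3}$ is the cylindrical $5$-puzzle. Conventions for $S_5$: a permutation $\sigma$ is written in one-line notation $\sigma(1)\sigma(2)\sigma(3)\sigma(4)\sigma(5)$ or in cycle notation, and products are compositions $(\sigma\tau)(i)=\sigma(\tau(i))$. Encoding: a position $f$ with blank at $b=(x_f,y_f)$ is encoded as $(\sigma_f,x_f,y_f)\in G=S_5\times\mathbb{Z}/2\mathbb{Z}\times\mathbb{Z}/3\mathbb{Z}$, where $\sigma_f$ has one-line notation $f((0,1)+b)\,f((0,2)+b)\,f((1,0)+b)\,f((1,1)+b)\,f((1,2)+b)$. Put $\mathtt R=(1,2)(3,4,5)$, $\mathtt L=(1,2)(3,5,4)$, $\mathtt V=(1,4)(2,5)$ in $S_5$, and $\hat{\mathtt R}=(\mathtt R,0,1)$, $\hat{\mathtt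 L}=(\mathtt L,0,2)$, $\hat{\mathtt V}=(\mathtt V,1,0)$ in $G$. Moving the blank from $b$ to $b+(0,1)$, $b+(0,2)$, $b+(1,0)$ corresponds to right multiplication by $\hat{\mathtt R}$, $\hat{\mathtt L}$, $\hat{\mathtt V}$ respectively. Thus $\mathrm{puz}(\Gamma_{2,3})$ is identified with $\mathrm{Cay}(G,\{\hat{\mathtt L},\hat{\mathtt R},\hat{\mathtt V}\})$, where $\mathrm{Cay}(H,S)$ has vertex set $H$ and an edge from $h_1$ to $h_2$ iff $h_1\xi=h_2$ for some $\xi\in S$. (Here $\hat{\mathtt R}^{-1}=\hat{\mathtt L}$ and $\hat{\mathtt V}^{-1}=\hat{\mathtt V}$, so the edges may be regarded as undirected.) *)

theory Defs
  imports "HOL-Algebra.Sym_Groups" "HOL-Algebra.Elementary_Groups" "Graph_Theory.Graph_Theory"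
begin

section \<open>State graphs of sliding block puzzles\<close>

text \<open>An undirected graph is a symmetric pair digraph, as in the locale \<open>pair_graph\<close>.
  Positions are extensional functions, so that each bijection from the vertex set onto
  \<open>{0, ..., n}\<close>, where \<open>n + 1\<close> is the number of vertices, is represented by one function.\<close>

definition positions :: "'v pair_pre_digraph \<Rightarrow> ('v \<Rightarrow> nat) set" where
  "positions \<Gamma> = {f \<in> extensional (pverts \<Gamma>). bij_betw f (pverts \<Gamma>) {..<card (pverts \<Gamma>)}}"

definition blank :: "'v pair_pre_digraph \<Rightarrow> ('v \<Rightarrow> nat) \<Rightarrow> 'v" where
  "blank \<Gamma> f = inv_into (pverts \<Gamma>) f 0"

definition is_move :: "'v pair_pre_digraph \<Rightarrow> ('v \<Rightarrow> nat) \<Rightarrow> ('v \<Rightarrow> nat) \<Rightarrow> bool" where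
  "is_move \<Gamma> f g \<longleftrightarrow>
     (\<exists>(v, w) \<in> parcs \<Gamma>. blank \<Gamma> f \<in> {v, w} \<and> g = f \<circ> Transposition.transpose v w)"

definition puz :: "'v pair_pre_digraph \<Rightarrow> ('v \<Rightarrow> nat) pair_pre_digraph" where
  "puz \<Gamma> = \<lparr>pverts = positions \<Gamma>,
            parcs = {(f, g) \<in> positions \<Gamma> \<times> positions \<Gamma>. is_move \<Gamma> f g}\<rparr>"

section \<open>The cylindrical 5-puzzle\<close>

abbreviation Z23 :: "(int \<times> int) monoid" where
  "Z23 \<equiv> integer_mod_group 2 \<times>\<times> integer_mod_group 3"

definition cyl_grid :: "(int \<times> int) pair_pre_digraph" where
  "cyl_grid = \<lparr>pverts = carrier Z23,
     parcs = {(v, w) \<in> carrier Z23 \<times> carrier Z23.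
                v \<otimes>\<^bsub>Z23\<^esub> inv\<^bsub>Z23\<^esub> w
                  \<in> {(1, 0), inv\<^bsub>Z23\<^esub> (1, 0), (0, 1), inv\<^bsub>Z23\<^esub> (0, 1)}}\<rparr>"

lemma pair_graph_difference:
  fixes H (structure)
  assumes "group H" and fin: "finite (carrier H)"
    and one: "\<one> \<notin> S" and symS: "\<And>x. x \<in> S \<Longrightarrow> inv x \<in> S"
  shows "pair_graph \<lparr>pverts = carrier H,
           parcs = {(v, w) \<in> carrier H \<times> carrier H. v \<otimes> inv w \<in> S}\<rparr>" (is "pair_graph ?X")
proof -
  interpret group H by fact
  have sym: "w \<otimes> inv v \<in> S" if "v \<in> carrier H" "w \<in> carrier H" "v \<otimes> inv w \<in> S" for v w
    using symS[OF that(3)] that(1,2) by (simp add: inv_mult_group)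
  have fin_arcs: "finite {(v, w) \<in> carrier H \<times> carrier H. v \<otimes> inv w \<in> S}"
    by (rule finite_subset[of _ "carrier H \<times> carrier H"]) (auto simp: fin)
  show ?thesis
    by unfold_locales
      (auto simp: fin fin_arcs[simplified] one sym symmetric_def arcs_ends_def arc_to_ends_def with_proj_def
        intro!: symI)
qed

lemma pair_graph_cyl_grid: "pair_graph cyl_grid"
  unfolding cyl_grid_def
proof (rule pair_graph_difference)
  show g: "group Z23"
    by (intro DirProd_group group_integer_mod_group)
  have inv: "inv\<^bsub>Z23\<^esub> (1, 0) = (1, 0)" "inv\<^bsub>Z23\<^esub> (0, 1) = (0, 2)" "inv\<^bsub>Z23\<^esub> (0, 2) = (0, 1)"
    by (rule group.inv_equality[OF g]; simp add: integer_mod_group_def)+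
  show "finite (carrier Z23)"
    by (simp add: carrier_integer_mod_group)
  show "\<one>\<^bsub>Z23\<^esub> \<notin> {(1, 0), inv\<^bsub>Z23\<^esub> (1, 0), (0, 1), inv\<^bsub>Z23\<^esub> (0, 1)}"
    unfolding inv by simp
  show "inv\<^bsub>Z23\<^esub> x \<in> {(1, 0), inv\<^bsub>Z23\<^esub> (1, 0), (0, 1), inv\<^bsub>Z23\<^esub> (0, 1)}"
    if "x \<in> {(1, 0), inv\<^bsub>Z23\<^esub> (1, 0), (0, 1), inv\<^bsub>Z23\<^esub> (0, 1)}" for x
    using that unfolding inv by (elim insertE emptyE) (simp_all only: inv insert_iff simp_thms)
qed

section \<open>Cayley graphs and the encoding of positions\<close>

definition Cay :: "('a, 'b) monoid_scheme \<Rightarrow> 'a set \<Rightarrow> 'a pair_pre_digraph" where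
  "Cay H S = \<lparr>pverts = carrier H,
              parcs = {(h1, h2) \<in> carrier H \<times> carrier H. \<exists>\<xi>\<in>S. h1 \<otimes>\<^bsub>H\<^esub> \<xi> = h2}\<rparr>"

abbreviation G :: "((nat \<Rightarrow> nat) \<times> int \<times> int) monoid" where
  "G \<equiv> sym_group 5 \<times>\<times> integer_mod_group 2 \<times>\<times> integer_mod_group 3"

definition one_line :: "nat list \<Rightarrow> nat \<Rightarrow> nat" where
  "one_line xs i = (if i \<in> {1..length xs} then xs ! (i - 1) else i)"

definition encode :: "(int \<times> int \<Rightarrow> nat) \<Rightarrow> (nat \<Rightarrow> nat) \<times> int \<times> int" where
  "encode f = (let b = blank cyl_grid f in
     (one_line (map (\<lambda>d. f (d \<otimes>\<^bsub>Z23\<^esub> b)) [(0, 1), (0, 2), (1, 0), (1, 1), (1, 2)]), b))"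

datatype letter = L | R | V

text \<open>\<open>cycle_of_list\<close> maps each list entry to the next one, and the last to the first.\<close>

fun hat :: "letter \<Rightarrow> (nat \<Rightarrow> nat) \<times> int \<times> int" where
  "hat R = (cycle_of_list [1, 2] \<circ> cycle_of_list [3, 4, 5], 0, 1)"
| "hat L = (cycle_of_list [1, 2] \<circ> cycle_of_list [3, 5, 4], 0, 2)"
| "hat V = (cycle_of_list [1, 4] \<circ> cycle_of_list [2, 5], 1, 0)"

section \<open>Graph isomorphisms and cycle covers\<close>

text \<open>The library treats arcs as separate objects with their own map; for pair digraphs that map
  is determined by the map on the vertices.\<close>

definition pair_iso :: "('a \<Rightarrow> 'b) \<Rightarrow> ('a, 'a \<times> 'a, 'b, 'b \<times> 'b) digraph_isomorphism" where
  "pair_iso \<phi> = \<lparr>iso_verts = \<phi>, iso_arcs = map_prod \<phi> \<phi>, iso_head = snd, iso_tail = fst\<rparr>"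

definition graph_iso_via ::
    "('a \<Rightarrow> 'b) \<Rightarrow> 'a pair_pre_digraph \<Rightarrow> 'b pair_pre_digraph \<Rightarrow> bool" where
  "graph_iso_via \<phi> X Y \<longleftrightarrow>
     pre_digraph.digraph_isomorphism (with_proj X) (pair_iso \<phi>) \<and>
     app_iso (pair_iso \<phi>) (with_proj X) = with_proj Y"

text \<open>A cycle is given by its list of vertices, in which the initial vertex is repeated at the end.
  The library notion of cycle allows \<open>u, v, u\<close>, which is not a cycle of an undirected graph.\<close>

definition simple_cycle :: "'a pair_pre_digraph \<Rightarrow> 'a list \<Rightarrow> bool" where
  "simple_cycle X c \<longleftrightarrow>
     pre_digraph.cycle (with_proj X) (vwalk_arcs c) \<and> 3 \<le> vwalk_length c"

definition cycle_cover :: "nat \<Rightarrow> 'a pair_pre_digraph \<Rightarrow> 'a list list \<Rightarrow> bool" where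
  "cycle_cover k X cs \<longleftrightarrow>
     length cs = k \<and>
     (\<forall>c \<in> set cs. simple_cycle X c) \<and>
     (\<forall>i<k. \<forall>j<k. i \<noteq> j \<longrightarrow> set (cs ! i) \<inter> set (cs ! j) = {}) \<and>
     (\<Union>c \<in> set cs. set c) = pverts X"

section \<open>The two cycles\<close>

definition s_word :: "letter list" where
  "s_word = [V, L, V, R, V, L, V, R, V, R, V, L,
             V, L, V, R, V, L, V, R, V, R, V, R]"

definition u_word :: "letter list" where
  "u_word = concat (replicate 15 s_word)"

definition q :: "nat \<Rightarrow> (nat \<Rightarrow> nat) \<times> int \<times> int" where
  "q i = foldl (\<lambda>g l. g \<otimes>\<^bsub>G\<^esub> hat l) (id, 0, 0) (take i u_word)"

definition a :: "nat \<Rightarrow> (nat \<Rightarrow> nat) \<times> int \<times> int" where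
  "a j = (id, int j, 0)"

definition C :: "nat \<Rightarrow> ((nat \<Rightarrow> nat) \<times> int \<times> int) list" where
  "C j = a j # map (\<lambda>i. a j \<otimes>\<^bsub>G\<^esub> q i) [1..<361]"

end

theory Submission
  imports Defs
begin

text \<open>One pass through the word of length 24 is \<open>q 24 = (p, 0, 2)\<close> with \<open>p\<close> a 5-cycle, an element of
  order 15, and \<open>q (24 k + i) = (q 24)\<^sup>k q i\<close>. Relabelling the values of a permutation so that \<open>p\<close>
  becomes addition of 1 modulo 5, left translation by \<open>q 24\<close> fixes all differences of values and
  the \<open>\<int>/2\<close>-coordinate (the \<open>key\<close>), while it shifts the value at 5 and the \<open>\<int>/3\<close>-coordinate
  (the \<open>phase\<close>) with period 15. The 48 elements \<open>a j \<otimes> q i\<close> with \<open>i < 24\<close> have distinct keys, so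
  the 720 vertices on the two cycles are distinct, and \<open>G\<close> has no more elements.

  For the encoding, a position with blank at \<open>b\<close> is \<open>\<sigma> \<circ> grid_index b\<close> with \<open>\<sigma>\<close> extended by
  \<open>\<sigma> 0 = 0\<close>; a move then amounts to an identity between index functions that does not involve \<open>\<sigma>\<close>.\<close>

section \<open>Cycles and isomorphisms of pair digraphs\<close>

text \<open>The first arc carries the start vertex, whereas a one-element list has no arcs and its
  vertex would be lost.\<close>

lemma pawalk_verts_vwalk_arcs: "2 \<le> length c \<Longrightarrow> pawalk_verts u (vwalk_arcs c) = c"
proof (induction c arbitrary: u rule: vwalk_arcs.induct)
  case (3 x y xs)
  then show ?case by (cases xs) auto
qed auto

lemma pcas_vwalk_arcs:
  "2 \<le> length c \<Longrightarrow> pcas u (vwalk_arcs c) v \<longleftrightarrow> u = hd c \<and> v = last c"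
proof (induction c arbitrary: u rule: vwalk_arcs.induct)
  case (3 x y xs)
  then show ?case using "3.IH"[of y] by (cases xs) auto
qed auto

lemma vwalk_arcs_map: "vwalk_arcs (map f c) = map (map_prod f f) (vwalk_arcs c)"
  by (induction c rule: vwalk_arcs.induct) auto

lemma set_vwalk_arcs_conv_nth:
  "set (vwalk_arcs c) = (\<lambda>i. (c ! i, c ! Suc i)) ` {..<length c - 1}"
proof (induction c rule: vwalk_arcs.induct)
  case (3 x y xs)
  then show ?case by (simp add: lessThan_Suc_eq_insert_0 image_image)
qed auto

lemma set_subset_of_vwalk_arcs:
  assumes "2 \<le> length c" "set (vwalk_arcs c) \<subseteq> W \<times> W"
  shows "set c \<subseteq> W"
  using assms
proof (induction c rule: vwalk_arcs.induct)
  case (3 x y xs)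
  then show ?case by (cases xs) auto
qed auto

text \<open>Reduces the library's notion on arc lists to checks on the vertex list. Three arcs mean
  four entries, since the initial vertex is repeated.\<close>

lemma simple_cycle_iff:
  assumes wf: "parcs X \<subseteq> pverts X \<times> pverts X"
  shows "simple_cycle X c \<longleftrightarrow>
    4 \<le> length c \<and> hd c = last c \<and> distinct (tl c) \<and> set (vwalk_arcs c) \<subseteq> parcs X"
proof (cases "4 \<le> length c")
  case True
  \<comment> \<open>\<open>awalk\<close> also asks that the start be a vertex; this follows from
    well-formedness, the start being the tail of an arc.\<close>
  have "hd c \<in> pverts X" if "set (vwalk_arcs c) \<subseteq> parcs X"
    using set_subset_of_vwalk_arcs[of c "pverts X"] that wf True by (cases c) auto
  moreover have "vwalk_arcs c \<noteq> []"
    using True by (cases c rule: vwalk_arcs.cases) auto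
  ultimately show ?thesis
    using True
    by (auto simp: simple_cycle_def pre_digraph.cycle_def pre_digraph.awalk_def
        cas_with_proj_eq awalk_verts_with_proj_eq pawalk_verts_vwalk_arcs pcas_vwalk_arcs)
qed (auto simp: simple_cycle_def)

section \<open>Transport along isomorphisms\<close>

text \<open>\<open>map_prod\<close> commutes with \<open>fst\<close> and \<open>snd\<close>, so
  tails and heads are respected automatically, and injectivity on arcs is inherited from
  vertices.\<close>

lemma graph_iso_via_iff:
  assumes "parcs X \<subseteq> pverts X \<times> pverts X"
  shows "graph_iso_via \<phi> X Y \<longleftrightarrow>
    bij_betw \<phi> (pverts X) (pverts Y) \<and> map_prod \<phi> \<phi> ` parcs X = parcs Y"
proof -
  have "wf_digraph (with_proj X)"
    using assms by unfold_locales auto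
  moreover have "inj_on (map_prod \<phi> \<phi>) (parcs X)" if "inj_on \<phi> (pverts X)"
    using map_prod_inj_on[OF that that] assms by (rule inj_on_subset)
  ultimately show ?thesis
    by (auto simp: graph_iso_via_def pre_digraph.digraph_isomorphism_def pair_iso_def app_iso_def
        with_proj_def bij_betw_def)
qed

lemma simple_cycle_inv_into:
  assumes wf: "parcs X \<subseteq> pverts X \<times> pverts X" and iso: "graph_iso_via \<phi> X Y"
    and c: "simple_cycle Y c"
  shows "simple_cycle X (map (inv_into (pverts X) \<phi>) c)"
proof -
  let ?\<psi> = "inv_into (pverts X) \<phi>"
  have bij: "bij_betw \<phi> (pverts X) (pverts Y)" and arcs: "map_prod \<phi> \<phi> ` parcs X = parcs Y"
    using iso graph_iso_via_iff[OF wf] by auto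
  have wfY: "parcs Y \<subseteq> pverts Y \<times> pverts Y"
    using wf bij unfolding arcs[symmetric] by (auto simp: bij_betw_def)
  have inv: "?\<psi> (\<phi> x) = x" if "x \<in> pverts X" for x
    using bij that by (simp add: bij_betw_def)
  have arc: "map_prod ?\<psi> ?\<psi> e \<in> parcs X" if "e \<in> parcs Y" for e
    using that wf inv unfolding arcs[symmetric] by (auto simp: subset_iff)
  have cyc: "4 \<le> length c" "hd c = last c" "distinct (tl c)" "set (vwalk_arcs c) \<subseteq> parcs Y"
    using c simple_cycle_iff[OF wfY] by auto
  have "c \<noteq> []"
    using cyc(1) by auto
  have "set c \<subseteq> pverts Y"
    using set_subset_of_vwalk_arcs[of c "pverts Y"] cyc(1,4) wfY by simp
  then have "inj_on ?\<psi> (set (tl c))"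
    using bij_betw_inv_into[OF bij]
    by (cases c) (auto simp: bij_betw_def intro: inj_on_subset)
  then show ?thesis
    using cyc arc \<open>c \<noteq> []\<close>
    by (auto simp: simple_cycle_iff[OF wf] vwalk_arcs_map distinct_map last_map hd_map
        simp flip: map_tl)
qed

lemma cycle_cover_inv_into:
  assumes wf: "parcs X \<subseteq> pverts X \<times> pverts X" and iso: "graph_iso_via \<phi> X Y"
    and cs: "cycle_cover k Y cs"
  shows "cycle_cover k X (map (map (inv_into (pverts X) \<phi>)) cs)"
proof -
  let ?\<psi> = "inv_into (pverts X) \<phi>"
  have "bij_betw \<phi> (pverts X) (pverts Y)"
    using iso graph_iso_via_iff[OF wf] by blast
  then have bij: "bij_betw ?\<psi> (pverts Y) (pverts X)"
    by (rule bij_betw_inv_into)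
  have Un: "(\<Union>c\<in>set cs. set c) = pverts Y" and len: "length cs = k"
    using cs by (auto simp: cycle_cover_def)
  have disj: "set (map ?\<psi> (cs ! i)) \<inter> set (map ?\<psi> (cs ! j)) = {}"
    if ij: "i < k" "j < k" "i \<noteq> j" for i j
  proof -
    have "set (cs ! i) \<subseteq> pverts Y" "set (cs ! j) \<subseteq> pverts Y"
      using ij len unfolding Un[symmetric] by (meson UN_upper nth_mem)+
    moreover have "set (cs ! i) \<inter> set (cs ! j) = {}"
      using cs ij by (simp add: cycle_cover_def)
    ultimately show ?thesis
      using inj_on_image_Int[OF bij_betw_imp_inj_on[OF bij]] by (metis image_empty set_map)
  qed
  have "(\<Union>c\<in>set cs. ?\<psi> ` set c) = pverts X"
    using bij unfolding Un[symmetric] by (simp add: bij_betw_def image_UN)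
  then show ?thesis
    using cs simple_cycle_inv_into[OF wf iso] disj len by (auto simp: cycle_cover_def)
qed

section \<open>The encoding\<close>

text \<open>Mixed-radix number of the displacement from \<open>b\<close> to \<open>v\<close>; the
  blank itself gets 0.\<close>

definition grid_index :: "int \<times> int \<Rightarrow> int \<times> int \<Rightarrow> nat" where
  "grid_index b v = nat (3 * ((fst v - fst b) mod 2) + (snd v - snd b) mod 3)"

lemma carrier_Z23: "carrier Z23 = {(0, 0), (0, 1), (0, 2), (1, 0), (1, 1), (1, 2)}"
proof -
  have "{0..<2::int} = {0, 1}" "{0..<3::int} = {0, 1, 2}"
    by auto
  then show ?thesis
    by (auto simp: carrier_integer_mod_group)
qed

lemma pverts_cyl_grid: "pverts cyl_grid = carrier Z23"
  by (simp add: cyl_grid_def)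

lemma card_pverts_cyl_grid: "card (pverts cyl_grid) = 6"
  unfolding pverts_cyl_grid carrier_Z23 by simp

lemma bij_betw_grid_index:
  assumes "b \<in> carrier Z23"
  shows "bij_betw (grid_index b) (carrier Z23) {..<6}"
proof (rule bij_betwI')
  show "grid_index b v = grid_index b w \<longleftrightarrow> v = w" if "v \<in> carrier Z23" "w \<in> carrier Z23" for v w
    using assms that unfolding carrier_Z23
    by (elim insertE emptyE) (simp_all add: grid_index_def)
  show "grid_index b v \<in> {..<6}" for v
    using pos_mod_bound[of 2 "fst v - fst b"] pos_mod_bound[of 3 "snd v - snd b"]
    unfolding grid_index_def lessThan_iff by linarith
  show "\<exists>v\<in>carrier Z23. i = grid_index b v" if "i \<in> {..<6}" for i
  proof -
    have "i \<in> {0, 1, 2, 3, 4, 5}"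
      using that by auto
    then show ?thesis
      using assms unfolding carrier_Z23
      by (elim insertE emptyE) (simp_all add: grid_index_def)
  qed
qed

text \<open>The explicit inverse of \<open>encode\<close>; \<open>restrict\<close> is there because
  positions are extensional.\<close>

definition position_of :: "(nat \<Rightarrow> nat) \<times> int \<times> int \<Rightarrow> (int \<times> int \<Rightarrow> nat)" where
  "position_of g = restrict (fst g \<circ> grid_index (snd g)) (carrier Z23)"

declare carrier_DirProd [simp del]

text \<open>Viewing S_5 as the stabiliser of 0 lets the blank be handled like any other
  value.\<close>

lemma permutes_lessThan_6:
  fixes s :: "nat \<Rightarrow> nat"
  shows "s permutes {1..5} \<longleftrightarrow> s permutes {..<6} \<and> s 0 = 0"
proof
  assume s: "s permutes {1..5}"
  then show "s permutes {..<6} \<and> s 0 = 0"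
    using permutes_subset[OF s, of "{..<6}"] permutes_not_in[OF s, of 0] by force
next
  assume "s permutes {..<6} \<and> s 0 = 0"
  then show "s permutes {1..5}"
    by (elim conjE permutes_superset) (auto simp: not_le)
qed

lemma carrier_G:
  "g \<in> carrier G \<longleftrightarrow> fst g permutes {..<6} \<and> fst g 0 = 0 \<and> snd g \<in> carrier Z23"
  by (cases g) (simp add: carrier_DirProd sym_group_carrier permutes_lessThan_6[simplified])

lemma position_of_in_positions:
  assumes "g \<in> carrier G"
  shows "position_of g \<in> positions cyl_grid"
proof -
  have "bij_betw (fst g \<circ> grid_index (snd g)) (carrier Z23) {..<6}"
    using assms
    by (intro bij_betw_trans[OF bij_betw_grid_index permutes_imp_bij]) (auto simp: carrier_G)
  then show ?thesis
    by (simp add: positions_def pverts_cyl_grid card_pverts_cyl_grid[unfolded pverts_cyl_grid]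
        position_of_def bij_betw_restrict_eq)
qed

lemma blank_eqI:
  assumes "f \<in> positions cyl_grid" "b \<in> carrier Z23" "f b = 0"
  shows "blank cyl_grid f = b"
  using assms by (auto simp: blank_def positions_def pverts_cyl_grid bij_betw_def
      intro: inv_into_f_eq)

lemma blank_position_of:
  assumes "g \<in> carrier G"
  shows "blank cyl_grid (position_of g) = snd g"
  using assms by (intro blank_eqI position_of_in_positions)
    (auto simp: carrier_G position_of_def grid_index_def)

text \<open>The displacements in the definition of \<open>encode\<close> are listed in the order of \<open>grid_index\<close>.\<close>

lemma one_line_grid_index:
  assumes "b \<in> carrier Z23"
  shows "v \<in> carrier Z23 \<Longrightarrow> v \<noteq> b \<Longrightarrow>
      one_line (map (\<lambda>d. f (d \<otimes>\<^bsub>Z23\<^esub> b)) [(0, 1), (0, 2), (1, 0), (1, 1), (1, 2)])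
        (grid_index b v) = f v"
  using assms unfolding carrier_Z23
  by (elim insertE emptyE) (simp_all add: one_line_def grid_index_def)

lemma encode_position_of:
  assumes g: "g \<in> carrier G"
  shows "encode (position_of g) = g"
proof -
  let ?f = "position_of g" and ?b = "snd g"
  let ?s = "one_line (map (\<lambda>d. ?f (d \<otimes>\<^bsub>Z23\<^esub> ?b)) [(0, 1), (0, 2), (1, 0), (1, 1), (1, 2)])"
  have b: "?b \<in> carrier Z23" and s: "fst g permutes {..<6}" "fst g 0 = 0"
    using g by (auto simp: carrier_G)
  have "?s i = fst g i" for i
  proof (cases "i \<in> {1..5}")
    case True
    then have "i \<in> grid_index ?b ` carrier Z23"
      using bij_betw_grid_index[OF b] by (auto simp: bij_betw_def)
    then obtain v where v: "v \<in> carrier Z23" "i = grid_index ?b v"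
      by blast
    \<comment> \<open>The blank has index 0, which is excluded by the range of
      \<open>i\<close>.\<close>
    have "v \<noteq> ?b"
      using True v by (auto simp: grid_index_def)
    have "?s i = ?f v"
      unfolding v(2) by (rule one_line_grid_index) fact+
    then show ?thesis
      using v by (simp add: position_of_def)
  next
    case False
    then show ?thesis
      using s permutes_not_in[OF s(1), of i] by (cases "i = 0") (auto simp: one_line_def)
  qed
  then have "?s = fst g"
    by blast
  then show ?thesis
    by (simp add: encode_def Let_def blank_position_of[OF g])
qed

text \<open>On the grid \<open>f\<close> factors as \<open>s\<close> after
  \<open>grid_index b\<close>; as \<open>f\<close> and \<open>grid_index b\<close> are bijections,
  so is \<open>s\<close>.\<close>

lemma position_of_encode:
  assumes f: "f \<in> positions cyl_grid"
  shows "encode f \<in> carrier G" and "position_of (encode f) = f"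
proof -
  define b where "b = blank cyl_grid f"
  define s where
    "s = one_line (map (\<lambda>d. f (d \<otimes>\<^bsub>Z23\<^esub> b)) [(0, 1), (0, 2), (1, 0), (1, 1), (1, 2)])"
  have enc: "encode f = (s, b)"
    by (simp add: encode_def Let_def s_def b_def)
  have ext: "f \<in> extensional (carrier Z23)" and bij: "bij_betw f (carrier Z23) {..<6}"
    using f by (auto simp: positions_def card_pverts_cyl_grid[unfolded pverts_cyl_grid] pverts_cyl_grid)
  then have "0 \<in> f ` carrier Z23"
    by (auto simp: bij_betw_def)
  then have b: "b \<in> carrier Z23" "f b = 0"
    unfolding b_def blank_def pverts_cyl_grid by (rule inv_into_into, rule f_inv_into_f)
  have s0: "s 0 = 0" "s i = i" if "i \<notin> {..<6}" for i
    using that by (auto simp: s_def one_line_def)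
  have s: "s (grid_index b v) = f v" if "v \<in> carrier Z23" for v
  proof (cases "v = b")
    case True
    then show ?thesis
      using b by (simp add: s_def one_line_def grid_index_def)
  qed (use one_line_grid_index[OF b(1) that] in \<open>simp add: s_def\<close>)
  have "bij_betw (s \<circ> grid_index b) (carrier Z23) {..<6}"
    using bij s by (simp cong: bij_betw_cong)
  then have "bij_betw s {..<6} {..<6}"
    using bij_betw_comp_iff[OF bij_betw_grid_index[OF b(1)]] by blast
  then have "s permutes {..<6}"
    using s0(2) by (rule bij_imp_permutes)
  then show "encode f \<in> carrier G"
    using b by (simp add: carrier_G enc s_def one_line_def)
  show "position_of (encode f) = f"
    using ext s by (auto simp: enc position_of_def extensional_def)
qed

lemma bij_betw_encode: "bij_betw encode (positions cyl_grid) (carrier G)"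
  by (rule bij_betw_byWitness[where f' = position_of])
    (auto simp: position_of_encode encode_position_of position_of_in_positions)

section \<open>Moves as right multiplication by generators\<close>

text \<open>The enumerated set, unlike an interval, lets the simplifier split into five
  evaluations.\<close>

lemma one_line_eqI:
  assumes "length xs = 5" "\<forall>i\<in>{1, 2, 3, 4, 5}. f i = xs ! (i - 1)"
    and "\<And>i. i \<notin> {1, 2, 3, 4, 5} \<Longrightarrow> f i = i"
  shows "f = one_line xs"
proof
  fix i :: nat
  have "i \<in> {1..5} \<longleftrightarrow> i \<in> {1, 2, 3, 4, 5}"
    by auto
  then show "f i = one_line xs i"
    using assms by (auto simp: one_line_def)
qed

lemma fst_hat:
  "fst (hat R) = one_line [2, 1, 4, 5, 3]"
  "fst (hat L) = one_line [2, 1, 5, 3, 4]"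
  "fst (hat V) = one_line [4, 5, 3, 1, 2]"
  by (rule one_line_eqI; auto simp: transpose_def)+

lemma snd_hat: "snd (hat R) = (0, 1)" "snd (hat L) = (0, 2)" "snd (hat V) = (1, 0)"
  by simp_all

declare hat.simps [simp del]

lemma mult_G: "g \<otimes>\<^bsub>G\<^esub> h = (fst g \<circ> fst h, snd g \<otimes>\<^bsub>Z23\<^esub> snd h)"
  by (simp add: mult_DirProd' sym_group_mult)

lemma hat_in_carrier: "hat l \<in> carrier G"
proof -
  have "cycle_of_list cs permutes {1..5}" if "set cs \<subseteq> {1..5}" for cs :: "nat list"
    using cycle_permutes that by (rule permutes_subset)
  then have "(cycle_of_list cs \<circ> cycle_of_list ds) permutes {1..5}"
    if "set cs \<subseteq> {1..5}" "set ds \<subseteq> {1..5}" for cs ds :: "nat list"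
    using that by (intro permutes_compose)
  then show ?thesis
    by (cases l) (simp_all add: hat.simps carrier_DirProd sym_group_carrier carrier_integer_mod_group
        del: cycle_of_list.simps)
qed

lemma group_Z23: "group Z23"
  by (intro DirProd_group group_integer_mod_group)

lemma group_G: "group G"
  by (intro DirProd_group group_integer_mod_group sym_group_is_group)

interpretation G: group G
  by (rule group_G)

lemma ball_Z23:
  "(\<forall>b\<in>carrier Z23. P b) \<longleftrightarrow>
     P (0, 0) \<and> P (0, 1) \<and> P (0, 2) \<and> P (1, 0) \<and> P (1, 1) \<and> P (1, 2)"
  unfolding carrier_Z23 by simp

text \<open>The move swaps the contents of the old and new blank, while \<open>hat l\<close>
  renumbers displacements from the new blank as displacements from the old one. With 36 pairs for
  each letter, evaluation decides the identity.\<close>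

lemma grid_index_transpose:
  "\<forall>b\<in>carrier Z23. \<forall>v\<in>carrier Z23.
     grid_index b (Transposition.transpose b (b \<otimes>\<^bsub>Z23\<^esub> snd (hat l)) v) =
     fst (hat l) (grid_index (b \<otimes>\<^bsub>Z23\<^esub> snd (hat l)) v)"
  unfolding ball_Z23
  by (cases l) (simp_all add: fst_hat one_line_def grid_index_def transpose_def snd_hat)

lemma position_of_mult_hat:
  assumes "g \<in> carrier G"
  shows "position_of (g \<otimes>\<^bsub>G\<^esub> hat l) =
    position_of g \<circ> Transposition.transpose (snd g) (snd g \<otimes>\<^bsub>Z23\<^esub> snd (hat l))"
proof
  fix v
  interpret Z: group Z23
    by (rule group_Z23)
  have b: "snd g \<in> carrier Z23" and w: "snd g \<otimes>\<^bsub>Z23\<^esub> snd (hat l) \<in> carrier Z23"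
    using assms hat_in_carrier[of l] by (auto simp: carrier_G)
  \<comment> \<open>Both blanks lie on the grid, so the restrictions on the two sides are undefined
    at the same points.\<close>
  then have "Transposition.transpose (snd g) (snd g \<otimes>\<^bsub>Z23\<^esub> snd (hat l)) v \<in> carrier Z23
      \<longleftrightarrow> v \<in> carrier Z23"
    by (auto simp: transpose_def)
  then show "position_of (g \<otimes>\<^bsub>G\<^esub> hat l) v =
      (position_of g \<circ> Transposition.transpose (snd g) (snd g \<otimes>\<^bsub>Z23\<^esub> snd (hat l))) v"
    using grid_index_transpose[of l] b by (simp add: position_of_def mult_G)
qed

lemma ex_letter: "(\<exists>l. P l) \<longleftrightarrow> P L \<or> P R \<or> P V"
  by (metis letter.exhaust)

text \<open>Adjacency is defined by the difference of \<open>b\<close> and \<open>w\<close>, while a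
  move adds a step to \<open>b\<close>. The two agree because the group is abelian and the set of
  steps is closed under inverses.\<close>

lemma parcs_cyl_grid_iff:
  assumes b: "b \<in> carrier Z23"
  shows "(b, w) \<in> parcs cyl_grid \<longleftrightarrow> (\<exists>l. w = b \<otimes>\<^bsub>Z23\<^esub> snd (hat l))"
proof -
  interpret Z: group Z23
    by (rule group_Z23)
  have hat: "snd (hat l) \<in> carrier Z23" for l
    using hat_in_carrier[of l] by (simp add: carrier_G)
  have inv: "inv\<^bsub>Z23\<^esub> snd (hat L) = snd (hat R)" "inv\<^bsub>Z23\<^esub> snd (hat R) = snd (hat L)"
    "inv\<^bsub>Z23\<^esub> snd (hat V) = snd (hat V)"
    by (rule Z.inv_equality[OF _ hat hat]; simp add: snd_hat)+
  then have S: "{(1, 0), inv\<^bsub>Z23\<^esub> (1, 0), (0, 1), inv\<^bsub>Z23\<^esub> (0, 1)} = {snd (hat V), snd (hat R), snd (hat L)}"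
    unfolding snd_hat by auto
  have "b \<otimes>\<^bsub>Z23\<^esub> inv\<^bsub>Z23\<^esub> w = s \<longleftrightarrow> w = b \<otimes>\<^bsub>Z23\<^esub> inv\<^bsub>Z23\<^esub> s"
    if "w \<in> carrier Z23" "s \<in> carrier Z23" for s
  proof -
    have "s \<otimes>\<^bsub>Z23\<^esub> w = w \<otimes>\<^bsub>Z23\<^esub> s"
      by (simp add: mult_DirProd' add.commute)
    then show ?thesis
      using that b Z.inv_solve_right[of s b w] Z.inv_solve_right[of w b s] by metis
  qed
  then have "b \<otimes>\<^bsub>Z23\<^esub> inv\<^bsub>Z23\<^esub> w \<in> {snd (hat V), snd (hat R), snd (hat L)}
      \<longleftrightarrow> w \<in> {b \<otimes>\<^bsub>Z23\<^esub> snd (hat V), b \<otimes>\<^bsub>Z23\<^esub> snd (hat L), b \<otimes>\<^bsub>Z23\<^esub> snd (hat R)}"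
    if "w \<in> carrier Z23"
    using hat that inv by simp
  moreover have "(\<exists>l. w = b \<otimes>\<^bsub>Z23\<^esub> snd (hat l)) \<longleftrightarrow>
      w \<in> {b \<otimes>\<^bsub>Z23\<^esub> snd (hat V), b \<otimes>\<^bsub>Z23\<^esub> snd (hat L), b \<otimes>\<^bsub>Z23\<^esub> snd (hat R)}"
    by (auto simp: ex_letter)
  moreover have "w \<in> carrier Z23" if "w = b \<otimes>\<^bsub>Z23\<^esub> snd (hat l)" for l
    using that b hat by simp
  ultimately show ?thesis
    using b unfolding cyl_grid_def S pair_pre_digraph.simps by blast
qed

lemma is_move_position_of:
  assumes g: "g \<in> carrier G"
  shows "is_move cyl_grid (position_of g) f \<longleftrightarrow> (\<exists>l. f = position_of (g \<otimes>\<^bsub>G\<^esub> hat l))"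
proof -
  have b: "snd g \<in> carrier Z23"
    using g by (simp add: carrier_G)
  \<comment> \<open>\<open>is_move\<close> allows the blank at either end of the arc; symmetry puts
    it first.\<close>
  have sym: "(w, v) \<in> parcs cyl_grid" if "(v, w) \<in> parcs cyl_grid" for v w
    using that pair_graph_cyl_grid
    by (auto simp: pair_graph_def pair_pseudo_graph_def pair_sym_digraph_def
        pair_sym_digraph_axioms_def symmetric_def dest: symD)
  have "is_move cyl_grid (position_of g) f \<longleftrightarrow>
      (\<exists>w. (snd g, w) \<in> parcs cyl_grid \<and> f = position_of g \<circ> Transposition.transpose (snd g) w)"
    (is "_ = ?R")
  proof
    assume "is_move cyl_grid (position_of g) f"
    then obtain v w where "(v, w) \<in> parcs cyl_grid" "snd g = v \<or> snd g = w"
      "f = position_of g \<circ> Transposition.transpose v w"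
      unfolding is_move_def blank_position_of[OF g] by blast
    then show ?R
      using sym transpose_commute by metis
  next
    assume ?R
    then show "is_move cyl_grid (position_of g) f"
      unfolding is_move_def blank_position_of[OF g] by blast
  qed
  then show ?thesis
    unfolding parcs_cyl_grid_iff[OF b] position_of_mult_hat[OF g] by metis
qed

lemma graph_iso_via_encode: "graph_iso_via encode (puz cyl_grid) (Cay G {hat L, hat R, hat V})"
proof -
  let ?X = "puz cyl_grid" and ?Y = "Cay G {hat L, hat R, hat V}"
  have arcs: "(position_of g, position_of h) \<in> parcs ?X \<longleftrightarrow> (g, h) \<in> parcs ?Y"
    if "g \<in> carrier G" "h \<in> carrier G" for g h
  proof -
    \<comment> \<open>\<open>position_of\<close> is injective on \<open>G\<close> because
      \<open>encode\<close> undoes it.\<close>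
    have "position_of h = position_of (g \<otimes>\<^bsub>G\<^esub> hat l) \<longleftrightarrow> g \<otimes>\<^bsub>G\<^esub> hat l = h" for l
      using that hat_in_carrier by (metis G.m_closed encode_position_of)
    then show ?thesis
      using that by (simp add: puz_def Cay_def position_of_in_positions is_move_position_of ex_letter)
  qed
  have "map_prod encode encode ` parcs ?X = parcs ?Y"
  proof (intro equalityI subrelI)
    fix g h assume "(g, h) \<in> map_prod encode encode ` parcs ?X"
    then obtain f f' where "(f, f') \<in> parcs ?X" "g = encode f" "h = encode f'"
      by auto
    moreover from this have "f \<in> positions cyl_grid" "f' \<in> positions cyl_grid"
      by (auto simp: puz_def)
    ultimately show "(g, h) \<in> parcs ?Y"
      using arcs[of g h] by (simp add: position_of_encode)
  next
    fix g h assume gh: "(g, h) \<in> parcs ?Y"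
    then have "g \<in> carrier G" "h \<in> carrier G"
      by (auto simp: Cay_def)
    then show "(g, h) \<in> map_prod encode encode ` parcs ?X"
      using arcs gh by (intro image_eqI[of _ _ "(position_of g, position_of h)"])
        (auto simp: encode_position_of)
  qed
  then show ?thesis
    using bij_betw_encode by (subst graph_iso_via_iff) (auto simp: puz_def Cay_def)
qed

section \<open>The two cycles\<close>

text \<open>Extends \<open>q\<close> from prefixes of \<open>u_word\<close> to all words, so that
  products split along concatenations.\<close>

definition word_prod :: "letter list \<Rightarrow> (nat \<Rightarrow> nat) \<times> int \<times> int" where
  "word_prod w = foldl (\<lambda>g l. g \<otimes>\<^bsub>G\<^esub> hat l) (id, 0, 0) w"

lemma one_G: "\<one>\<^bsub>G\<^esub> = (id, 0, 0)"
  by (simp add: sym_group_one)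

lemma word_prod_Nil: "word_prod [] = \<one>\<^bsub>G\<^esub>"
  by (simp add: word_prod_def sym_group_one)

lemma word_prod_snoc: "word_prod (w @ [l]) = word_prod w \<otimes>\<^bsub>G\<^esub> hat l"
  by (simp add: word_prod_def)

lemma word_prod_closed: "word_prod w \<in> carrier G"
  by (induction w rule: rev_induct)
    (simp_all add: word_prod_Nil word_prod_snoc hat_in_carrier del: one_DirProd)

lemma word_prod_append: "word_prod (v @ w) = word_prod v \<otimes>\<^bsub>G\<^esub> word_prod w"
proof (induction w rule: rev_induct)
  case Nil
  then show ?case by (simp add: word_prod_Nil word_prod_closed del: one_DirProd)
next
  case (snoc l w)
  then show ?case
    by (simp add: word_prod_snoc word_prod_closed hat_in_carrier G.m_assoc flip: append_assoc)
qed

lemma q_eq_word_prod: "q i = word_prod (take i u_word)"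
  by (simp add: q_def word_prod_def)

lemma q_closed: "q i \<in> carrier G"
  by (simp add: q_eq_word_prod word_prod_closed)

lemma q_0: "q 0 = \<one>\<^bsub>G\<^esub>"
  by (simp add: q_eq_word_prod word_prod_Nil del: one_DirProd)

lemma length_s_word: "length s_word = 24"
  by (simp add: s_word_def)

lemma length_u_word: "length u_word = 360"
  by (simp add: u_word_def length_concat length_s_word sum_list_replicate)

lemma u_word_unfold:
  "u_word = s_word @ concat (replicate 14 s_word)"
  "u_word = concat (replicate 14 s_word) @ s_word"
  by (simp_all add: u_word_def eval_nat_numeral)

lemma q_Suc: "i < 360 \<Longrightarrow> q (Suc i) = q i \<otimes>\<^bsub>G\<^esub> hat (u_word ! i)"
  by (simp add: q_eq_word_prod take_Suc_conv_app_nth length_u_word word_prod_snoc)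

lemma q_eq_word_prod_s_word: "i \<le> 24 \<Longrightarrow> q i = word_prod (take i s_word)"
  by (simp add: q_eq_word_prod u_word_unfold(1) length_s_word)

lemma q_add_24:
  assumes "n \<le> 336"
  shows "q (24 + n) = q 24 \<otimes>\<^bsub>G\<^esub> q n"
proof -
  have "take (24 + n) u_word = s_word @ take n (concat (replicate 14 s_word))"
    by (simp add: u_word_unfold(1) length_s_word)
  \<comment> \<open>The 14 remaining passes have 14 * 24 = 336 letters, so the first
    \<open>n\<close> of them form a prefix of \<open>u_word\<close> as well.\<close>
  also have "take n (concat (replicate 14 s_word)) = take n u_word"
    using assms by (simp add: u_word_unfold(2) length_concat length_s_word sum_list_replicate)
  finally show ?thesis
    by (simp add: q_eq_word_prod word_prod_append[symmetric] u_word_unfold(1) length_s_word)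
qed

lemma one_line_comp_hat:
  "one_line [i, j, k, m, n] \<circ> fst (hat R) = one_line [j, i, m, n, k]"
  "one_line [i, j, k, m, n] \<circ> fst (hat L) = one_line [j, i, n, k, m]"
  "one_line [i, j, k, m, n] \<circ> fst (hat V) = one_line [m, n, k, i, j]"
  by (rule one_line_eqI; auto simp: fst_hat one_line_def)+

text \<open>As rewrite rules these multiply out a word letter by letter on explicit lists.\<close>

lemma one_line_mult_hat:
  "(one_line [i, j, k, m, n], x, y) \<otimes>\<^bsub>G\<^esub> hat R = (one_line [j, i, m, n, k], x mod 2, (y + 1) mod 3)"
  "(one_line [i, j, k, m, n], x, y) \<otimes>\<^bsub>G\<^esub> hat L = (one_line [j, i, n, k, m], x mod 2, (y + 2) mod 3)"
  "(one_line [i, j, k, m, n], x, y) \<otimes>\<^bsub>G\<^esub> hat V = (one_line [m, n, k, i, j], (x + 1) mod 2, y mod 3)"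
  by (simp_all add: mult_G one_line_comp_hat snd_hat)

lemma id_eq_one_line: "id = one_line [1, 2, 3, 4, 5]"
  by (rule one_line_eqI) auto

lemmas word_prod_eval = word_prod_def id_eq_one_line one_line_mult_hat

lemma q_24: "q 24 = (one_line [5, 3, 4, 1, 2], 0, 2)"
  by (simp add: q_eq_word_prod_s_word s_word_def word_prod_eval)

lemma q_360: "q 360 = \<one>\<^bsub>G\<^esub>"
proof -
  have "q 360 = word_prod u_word"
    by (simp add: q_eq_word_prod length_u_word)
  \<comment> \<open>A \<open>map\<close> over \<open>upt\<close> unfolds to an explicit word, whose
    360 factors are then multiplied out by simplification.\<close>
  also have "u_word = concat (map (\<lambda>_. s_word) [0..<15])"
    by (simp add: u_word_def map_replicate_const)
  also have "word_prod \<dots> = \<one>\<^bsub>G\<^esub>"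
    by (simp add: upt_rec s_word_def word_prod_eval sym_group_one)
  finally show ?thesis .
qed

section \<open>Left translation by \<open>q 24\<close>: key and phase\<close>

text \<open>\<open>label v\<close> is the exponent \<open>e\<close> with \<open>v = p\<^sup>e 1\<close>, where \<open>p\<close> is the
  5-cycle \<open>1 \<mapsto> 5 \<mapsto> 2 \<mapsto> 3 \<mapsto> 4 \<mapsto> 1\<close> in \<open>q 24 = (p, 0, 2)\<close>.\<close>

definition label :: "nat \<Rightarrow> int" where
  "label v = [0, 2, 3, 4, 1] ! (v - 1)"

text \<open>On \<open>G\<close> the four label differences from position 5 are 1, ..., 4 in some
  order, so three of them fix the fourth. The 2 * 4! = 48 keys thus name the right cosets of the
  subgroup of order 15 generated by \<open>q 24\<close>.\<close>

definition key :: "(nat \<Rightarrow> nat) \<times> int \<times> int \<Rightarrow> int \<times> int list" where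
  "key g = (fst (snd g), map (\<lambda>m. (label (fst g m) - label (fst g 5)) mod 5) [1, 2, 3])"

definition phase :: "(nat \<Rightarrow> nat) \<times> int \<times> int \<Rightarrow> int \<times> int" where
  "phase g = (label (fst g 5), snd (snd g))"

lemma a_mult: "a j \<otimes>\<^bsub>G\<^esub> g = (fst g, (int j + fst (snd g)) mod 2, snd (snd g) mod 3)"
  by (simp add: a_def mult_DirProd' sym_group_mult)

lemma key_one_line:
  "key (one_line [i, j, k, m, n], x, y) =
     (x, map (\<lambda>l. (label l - label n) mod 5) [i, j, k])"
  by (simp add: key_def one_line_def)

lemma inj_on_key: "inj_on (\<lambda>(j, i). key (a j \<otimes>\<^bsub>G\<^esub> q i)) ({0, 1} \<times> {..<24})"
proof -
  let ?k = "\<lambda>(j, i). key (a j \<otimes>\<^bsub>G\<^esub> word_prod (take i s_word))"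
  \<comment> \<open>All 48 keys are computed and compared.\<close>
  have "distinct (map ?k (List.product [0, 1] [0..<24]))"
    by (simp add: upt_rec s_word_def word_prod_eval a_mult key_one_line label_def)
  then have "inj_on ?k (set (List.product [0, 1] [0..<24]))"
    unfolding distinct_map by blast
  also have "set (List.product [0, 1] [0..<24]) = {0, 1} \<times> {..<24}"
    by auto
  finally show ?thesis
    by (subst inj_on_cong[where g = ?k]) (auto simp: q_eq_word_prod_s_word)
qed

lemma phase_a_mult: "g \<in> carrier G \<Longrightarrow> phase (a j \<otimes>\<^bsub>G\<^esub> g) = phase g"
  by (auto simp: phase_def a_mult carrier_G carrier_Z23)

text \<open>The translated key depends on \<open>g\<close> only through \<open>key g\<close>, so
  equal keys stay equal under translation by \<open>a j\<close>.\<close>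

lemma key_a_mult: "key (a j \<otimes>\<^bsub>G\<^esub> g) = ((int j + fst (key g)) mod 2, snd (key g))"
  by (simp add: key_def a_mult)

lemma label_range: "v \<in> {1..5} \<Longrightarrow> label v \<in> {0..<5}"
proof -
  assume "v \<in> {1..5}"
  then have "v \<in> {1, 2, 3, 4, 5}"
    by auto
  then show ?thesis
    by (auto simp: label_def)
qed

lemma label_one_line: "v \<in> {1..5} \<Longrightarrow> label (one_line [5, 3, 4, 1, 2] v) = (label v + 1) mod 5"
proof -
  assume "v \<in> {1..5}"
  then have "v \<in> {1, 2, 3, 4, 5}"
    by auto
  then show ?thesis
    by (auto simp: label_def one_line_def)
qed

text \<open>Left multiplication applies the 5-cycle to the values, adding 1 modulo 5 to every label;
  differences of labels do not see this.\<close>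

lemma q_24_mult:
  assumes "g \<in> carrier G"
  shows "key (q 24 \<otimes>\<^bsub>G\<^esub> g) = key g"
    and "phase (q 24 \<otimes>\<^bsub>G\<^esub> g) = ((fst (phase g) + 1) mod 5, (snd (phase g) + 2) mod 3)"
proof -
  have "fst g permutes {1..5}"
    using assms unfolding carrier_G permutes_lessThan_6 by simp
  then have "fst g i \<in> {1..5}" if "i \<in> {1..5}" for i
    using that by (simp only: permutes_in_image)
  then have label: "label (one_line [5, 3, 4, 1, 2] (fst g i)) = (label (fst g i) + 1) mod 5"
    if "i \<in> {1..5}" for i
    using that by (intro label_one_line)
  \<comment> \<open>Adding 0 in Z/2 still reduces modulo 2, so the coordinate must already be
    reduced.\<close>
  have "fst (snd g) mod 2 = fst (snd g)"
    using assms by (auto simp: carrier_G carrier_Z23)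
  then show "key (q 24 \<otimes>\<^bsub>G\<^esub> g) = key g"
    by (simp add: key_def q_24 mult_DirProd' sym_group_mult label[simplified] mod_diff_eq)
  show "phase (q 24 \<otimes>\<^bsub>G\<^esub> g) = ((fst (phase g) + 1) mod 5, (snd (phase g) + 2) mod 3)"
    by (simp add: phase_def q_24 mult_DirProd' sym_group_mult label[simplified] add.commute)
qed

lemma phase_range:
  assumes "g \<in> carrier G"
  shows "phase g \<in> {0..<5} \<times> {0..<3}"
proof -
  have "fst g permutes {1..5}"
    using assms unfolding carrier_G permutes_lessThan_6 by simp
  then have "fst g 5 \<in> {1..5}"
    by (simp only: permutes_in_image) simp
  then show ?thesis
    using label_range[of "fst g 5"] assms by (auto simp: phase_def carrier_G carrier_Z23)
qed

lemma q_block: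
  assumes "24 * k + i \<le> 360"
  shows "key (q (24 * k + i)) = key (q i)"
    and "phase (q (24 * k + i)) =
      ((fst (phase (q i)) + int k) mod 5, (snd (phase (q i)) + 2 * int k) mod 3)"
  using assms
proof (induction k)
  case 0
  {
    case 1
    then show ?case by simp
  next
    case 2
    \<comment> \<open>For \<open>k = 0\<close> the two reductions act trivially on a phase within
      its range.\<close>
    then show ?case
      using phase_range[OF q_closed[of i]] by (cases "phase (q i)") simp
  }
next
  case (Suc k)
  have q: "q (24 * Suc k + i) = q 24 \<otimes>\<^bsub>G\<^esub> q (24 * k + i)" if "24 * Suc k + i \<le> 360"
    using q_add_24[of "24 * k + i"] that by (simp add: algebra_simps)
  {
    case 1
    then show ?case
      using Suc.IH(1) q by (simp add: q_24_mult q_closed)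
  next
    case 2
    then show ?case
      using Suc.IH(2) q by (simp add: q_24_mult q_closed mod_simps algebra_simps)
  }
qed

section \<open>Distinctness of the 720 vertices and the cover\<close>

lemma inj_on_a_mult_q: "inj_on (\<lambda>(j, n). a j \<otimes>\<^bsub>G\<^esub> q n) ({0, 1} \<times> {..<360})"
proof (rule inj_onI, clarify)
  fix j j' n n' :: nat
  assume j: "j \<in> {0, 1}" "j' \<in> {0, 1}" and n: "n < 360" "n' < 360"
    and eq: "a j \<otimes>\<^bsub>G\<^esub> q n = a j' \<otimes>\<^bsub>G\<^esub> q n'"
  define k i k' i' where "k = n div 24" "i = n mod 24" "k' = n' div 24" "i' = n' mod 24"
  note defs = this
  have dec: "n = 24 * k + i" "n' = 24 * k' + i'" "i < 24" "i' < 24" "k < 15" "k' < 15"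
    using n by (auto simp: defs)
  \<comment> \<open>Keys ignore full passes, so they determine the cycle and the offset within a
    pass.\<close>
  have "key (a j \<otimes>\<^bsub>G\<^esub> q i) = key (a j' \<otimes>\<^bsub>G\<^esub> q i')"
    using arg_cong[OF eq, of key] n by (simp add: key_a_mult dec q_block)
  then have ji: "j = j'" "i = i'"
    using inj_onD[OF inj_on_key, of "(j, i)" "(j', i')"] j dec by auto
  have "phase (q n) = phase (q n')"
    using arg_cong[OF eq, of phase] by (simp add: phase_a_mult q_closed)
  \<comment> \<open>\<open>(l, y)\<close> is the common phase of \<open>q i\<close>, from which both
    \<open>q n\<close> and \<open>q n'\<close> start.\<close>
  then obtain l y where ly: "(l + int k) mod 5 = (l + int k') mod 5"
      "(y + 2 * int k) mod 3 = (y + 2 * int k') mod (3::int)"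
    using n unfolding dec ji by (auto simp: q_block)
  \<comment> \<open>The difference is divisible by 5 and, as 2 is invertible modulo 3, by 3; being
    smaller than 15 in absolute value, it vanishes.\<close>
  then have "5 dvd int k - int k'" "3 dvd 2 * (int k - int k')"
    by (simp_all add: mod_eq_dvd_iff algebra_simps)
  then have "k = k'"
    using dec(5,6) by presburger
  then show "j = j' \<and> n = n'"
    using ji dec by simp
qed

lemma card_carrier_G: "card (carrier G) = 720"
  by (simp add: carrier_DirProd card_cartesian_product sym_group_card_carrier carrier_integer_mod_group
      fact_numeral)

lemma a_closed: "j \<in> {0, 1} \<Longrightarrow> a j \<in> carrier G"
  by (auto simp: a_def carrier_G carrier_Z23)

text \<open>The separate head \<open>a j\<close> is the term for index 0, since \<open>q 0\<close>
  is the identity.\<close>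

lemma C_eq: "j \<in> {0, 1} \<Longrightarrow> C j = map (\<lambda>n. a j \<otimes>\<^bsub>G\<^esub> q n) [0..<361]"
  using upt_conv_Cons[of 0 361] by (simp add: C_def q_0 a_closed del: one_DirProd upt_Suc)

lemma set_C:
  assumes "j \<in> {0, 1}"
  shows "set (C j) = (\<lambda>n. a j \<otimes>\<^bsub>G\<^esub> q n) ` {..<360}"
proof -
  have "{0..<361} = insert 360 {..<360::nat}"
    by auto
  moreover have "a j \<otimes>\<^bsub>G\<^esub> q 360 = a j \<otimes>\<^bsub>G\<^esub> q 0"
    by (simp add: q_360 q_0)
  ultimately show ?thesis
    using assms by (auto simp: C_eq)
qed

lemma wf_Cay: "parcs (Cay H S) \<subseteq> pverts (Cay H S) \<times> pverts (Cay H S)"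
  by (auto simp: Cay_def)

lemma Cay_arcI:
  "h \<in> carrier H \<Longrightarrow> \<xi> \<in> S \<Longrightarrow> h \<otimes>\<^bsub>H\<^esub> \<xi> \<in> carrier H \<Longrightarrow> (h, h \<otimes>\<^bsub>H\<^esub> \<xi>) \<in> parcs (Cay H S)"
  by (auto simp: Cay_def)

lemma wf_puz: "parcs (puz \<Gamma>) \<subseteq> pverts (puz \<Gamma>) \<times> pverts (puz \<Gamma>)"
  by (auto simp: puz_def)

lemma simple_cycle_C:
  assumes j: "j \<in> {0, 1}"
  shows "simple_cycle (Cay G {hat L, hat R, hat V}) (C j)"
proof -
  let ?f = "\<lambda>n. a j \<otimes>\<^bsub>G\<^esub> q n"
  have f360: "?f 360 = ?f 0"
    by (simp add: q_360 q_0)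
  have inj: "inj_on ?f {..<360}"
    using inj_on_a_mult_q j by (auto simp: inj_on_def)
  \<comment> \<open>\<open>tl (C j)\<close> has indices 1 to 360, while injectivity is known for 0
    to 359; index 360 takes over from 0, with the same value.\<close>
  then have "?f 0 \<notin> ?f ` {1..<360}"
    by (subst inj_on_image_mem_iff) auto
  then have "inj_on ?f (insert 360 {1..<360})"
    using inj f360 by (auto intro: inj_on_subset)
  also have "insert 360 {1..<360} = {1..<361::nat}"
    by auto
  finally have "inj_on ?f {1..<361}" .
  then have "distinct (tl (C j))"
    by (simp add: C_def distinct_map)
  moreover have "hd (C j) = last (C j)"
    using f360 by (simp add: C_eq[OF j] hd_map last_map)
  moreover have "(?f n, ?f (Suc n)) \<in> parcs (Cay G {hat L, hat R, hat V})" if "n < 360" for n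
  proof -
    have "hat l \<in> {hat L, hat R, hat V}" for l
      by (cases l) auto
    then show ?thesis
      using Cay_arcI[of "?f n" G "hat (u_word ! n)"] j
      by (simp add: q_Suc[OF that] a_closed q_closed hat_in_carrier G.m_assoc)
  qed
  then have "set (vwalk_arcs (C j)) \<subseteq> parcs (Cay G {hat L, hat R, hat V})"
    by (auto simp: C_eq[OF j] set_vwalk_arcs_conv_nth nth_upt simp del: upt_Suc)
  ultimately show ?thesis
    by (simp add: simple_cycle_iff[OF wf_Cay] C_def)
qed

lemma cycle_cover_C: "cycle_cover 2 (Cay G {hat L, hat R, hat V}) [C 0, C 1]"
proof -
  let ?f = "\<lambda>(j, n). a j \<otimes>\<^bsub>G\<^esub> q n" and ?D = "{0, 1} \<times> {..<360::nat}"
  have "?f ` ?D = carrier G"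
  \<comment> \<open>The image has 2 * 360 elements, the order of \<open>G\<close>, hence is all of
    it.\<close>
  proof (rule card_subset_eq)
    show "finite (carrier G)"
      using card_carrier_G by (intro card_ge_0_finite) simp
    show "?f ` ?D \<subseteq> carrier G"
      by (auto simp: a_closed q_closed)
    show "card (?f ` ?D) = card (carrier G)"
      unfolding card_image[OF inj_on_a_mult_q] card_carrier_G by (simp add: card_cartesian_product)
  qed
  moreover have "?f ` ?D = set (C 0) \<union> set (C 1)"
    by (auto simp: set_C image_iff)
  moreover have "set (C 0) \<inter> set (C 1) = {}"
    using inj_on_a_mult_q by (auto simp: set_C inj_on_def)
  ultimately show ?thesis
    using simple_cycle_C by (auto simp: cycle_cover_def less_2_cases_iff Cay_def)
qed

theorem mainTheorem3:
  fixes X :: "(int \<times> int \<Rightarrow> nat) pair_pre_digraph"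
    and Y :: "((nat \<Rightarrow> nat) \<times> int \<times> int) pair_pre_digraph"
    and decode :: "(nat \<Rightarrow> nat) \<times> int \<times> int \<Rightarrow> (int \<times> int \<Rightarrow> nat)"
  assumes "X = puz cyl_grid"
    and "Y = Cay G {hat L, hat R, hat V}"
    and "decode = inv_into (pverts X) encode"
  shows "graph_iso_via encode X Y \<and>
         (\<forall>j\<in>{0, 1}. simple_cycle Y (C j) \<and> vwalk_length (C j) = 360 \<and>
                     a j \<otimes>\<^bsub>G\<^esub> q 360 = a j) \<and>
         cycle_cover 2 Y [C 0, C 1] \<and>
         (\<forall>j\<in>{0, 1}. simple_cycle X (map decode (C j)) \<and>
                     vwalk_length (map decode (C j)) = 360) \<and>
         cycle_cover 2 X [map decode (C 0), map decode (C 1)]"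
proof -
  have iso: "graph_iso_via encode X Y"
    unfolding assms(1,2) by (rule graph_iso_via_encode)
  have wf: "parcs X \<subseteq> pverts X \<times> pverts X"
    unfolding assms(1) by (rule wf_puz)
  have len: "length (C j) = 361" for j
    by (simp add: C_def)
  have Y: "simple_cycle Y (C j)" if "j \<in> {0, 1}" for j
    unfolding assms(2) using that by (rule simple_cycle_C)
  have cover: "cycle_cover 2 Y [C 0, C 1]"
    unfolding assms(2) by (rule cycle_cover_C)
  have "a j \<otimes>\<^bsub>G\<^esub> q 360 = a j" if "j \<in> {0, 1}" for j
    unfolding q_360 using that by (intro G.r_one a_closed)
  moreover have "simple_cycle X (map decode (C j))" if "j \<in> {0, 1}" for j
    unfolding assms(3) using wf iso Y[OF that] by (rule simple_cycle_inv_into)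
  moreover have "cycle_cover 2 X [map decode (C 0), map decode (C 1)]"
    using cycle_cover_inv_into[OF wf iso cover] by (simp add: assms(3))
  ultimately show ?thesis
    using iso Y cover len by simp
qed

end
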